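(* Let $0<p<1$ and $2\le q<\infty$, and let $(u^{(n)})_{n}$, $(v^{(n)})_{n}$ be sequences in $\ell_2(\Lambda)$ produced by the alternating algorithm (defined in the context). Then the weak accumulation points of these sequences are fixed points: if $(u^\infty,v^\infty)\in\ell_2(\Lambda)\times\ell_2(\Lambda)$ is such that $u^{(n_j)}\rightharpoonup u^\infty$ and $v^{(n_j)}\rightharpoonup v^\infty$ weakly in $\ell_2(\Lambda)$ along some subsequence $(n_j)$, then $$u^\infty = \operatorname{argmin}_{u\in\ell_2(\Lambda)} J_u^s(u,v^\infty;u^\infty),\qquad v^\infty=\operatorname{argmin}_{v\in\ell_2(\Lambda)} J_v^s(u^\infty,v;v^\infty).$$
   Context: $\Lambda$ is a countable index set, $\ell_r=\ell_r(\Lambda)$ the real sequence spaces with (quasi-)norms $\|\cdot\|_r$, $\mathcal H$ a separable Hilbert space, $T:\ell_2(\Lambda)\to\mathcal H$ a bounded linear operator with $\|T\|<1$, $y\in\mathcal H$, and $\alpha,\beta,\varepsilon>0$. Define $$J_{p,q}(u,v)=\|T(u+v)-y\|_{\mathcal H}^2+\alpha\|u\|_p^p+\left(\beta\|v\|_q^q+\varepsilon\|v\|_2^2\right)$$ (value $+\infty$ if $u\notin\ell_p$), and the surrogate functionals, for $a\in\ell_2(\Lambda)$, $$J_u^s(u,v;a)=J_{p,q}(u,v)+\|u-a\|_2^2-\|Tu-Ta\|_{\mathcal H}^2,\qquad J_v^s(u,v;a)=J_{p,q}(u,v)+\|v-a\|_2^2-\|Tv-Ta\|_{\mathcal H}^2.$$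 Alternating algorithm: fix integers $L,M\ge1$ and initial $u^{(0)},v^{(0)}\in\ell_2(\Lambda)$. For $n=0,1,2,\dots$: set $u^{(n+1,0)}=u^{(n)}$ and $u^{(n+1,l+1)}=\operatorname{argmin}_{u\in\ell_2(\Lambda)}J_u^s(u,v^{(n)};u^{(n+1,l)})$ for $l=0,\dots,L-1$, and $u^{(n+1)}=u^{(n+1,L)}$; then set $v^{(n+1,0)}=v^{(n)}$ and $v^{(n+1,l+1)}=\operatorname{argmin}_{v\in\ell_2(\Lambda)}J_v^s(u^{(n+1)},v;v^{(n+1,l)})$ for $l=0,\dots,M-1$, and $v^{(n+1)}=v^{(n+1,M)}$. When a minimizer is not unique, "$x=\operatorname{argmin}$" means that $x$ is a minimizer. *)

theory Defs
  imports "HOL-Analysis.Analysis"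
begin

section \<open>Sequence spaces\<close>

definition ell :: "real \<Rightarrow> ('i \<Rightarrow> real) set" where
  "ell r = {x. (\<lambda>i. \<bar>x i\<bar> powr r) summable_on UNIV}"

definition ell_norm :: "real \<Rightarrow> ('i \<Rightarrow> real) \<Rightarrow> real" where
  "ell_norm r x = (\<Sum>\<^sub>\<infinity>i. \<bar>x i\<bar> powr r) powr (1 / r)"

lemma ell_two_iff: "x \<in> ell 2 \<longleftrightarrow> (\<lambda>i. (x i)\<^sup>2) summable_on UNIV"
  by (simp add: ell_def)

lemma ell_two_summable_mult:
  assumes "x \<in> ell 2" "y \<in> ell 2"
  shows "(\<lambda>i. x i * y i) summable_on UNIV"
proof -
  have "(\<lambda>i. norm (x i * y i)) summable_on UNIV"
    by (rule abs_summable_product) (use assms in \<open>simp_all add: ell_two_iff power2_eq_square\<close>)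
  then show ?thesis
    by (rule abs_summable_summable)
qed

lemma ell_two_add:
  assumes "x \<in> ell 2" "y \<in> ell 2"
  shows "(\<lambda>i. x i + y i) \<in> ell 2"
proof -
  have "(\<lambda>i. (x i)\<^sup>2 + (y i)\<^sup>2 + 2 * (x i * y i)) summable_on UNIV"
    using assms ell_two_summable_mult[OF assms]
    by (intro summable_on_add summable_on_cmult_right) (simp_all add: ell_two_iff)
  then show ?thesis
    by (simp add: ell_two_iff power2_sum mult.assoc)
qed

lemma ell_two_scale:
  assumes "x \<in> ell 2"
  shows "(\<lambda>i. c * x i) \<in> ell 2"
  using assms summable_on_cmult_right[of "\<lambda>i. (x i)\<^sup>2" UNIV "c\<^sup>2"]
  by (simp add: ell_two_iff power_mult_distrib)

typedef 'i ell2 = "ell 2 :: ('i \<Rightarrow> real) set"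
  morphisms coord Abs_ell2
proof
  show "(\<lambda>_. 0) \<in> ell 2"
    by (simp add: ell_two_iff)
qed

setup_lifting type_definition_ell2

lemma ell2_eqI: "(\<And>i. coord x i = coord y i) \<Longrightarrow> x = y"
  by (metis coord_inject ext)

instantiation ell2 :: (type) real_inner
begin

lift_definition zero_ell2 :: "'a ell2" is "\<lambda>_. 0"
  by (simp add: ell_two_iff)

lift_definition plus_ell2 :: "'a ell2 \<Rightarrow> 'a ell2 \<Rightarrow> 'a ell2" is "\<lambda>x y i. x i + y i"
  by (rule ell_two_add)

lift_definition scaleR_ell2 :: "real \<Rightarrow> 'a ell2 \<Rightarrow> 'a ell2" is "\<lambda>c x i. c * x i"
  by (rule ell_two_scale)

lift_definition uminus_ell2 :: "'a ell2 \<Rightarrow> 'a ell2" is "\<lambda>x i. - x i"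
  by (simp add: ell_two_iff)

definition minus_ell2 :: "'a ell2 \<Rightarrow> 'a ell2 \<Rightarrow> 'a ell2" where
  "minus_ell2 x y = x + - y"

definition inner_ell2 :: "'a ell2 \<Rightarrow> 'a ell2 \<Rightarrow> real" where
  "inner_ell2 x y = (\<Sum>\<^sub>\<infinity>i. coord x i * coord y i)"

definition norm_ell2 :: "'a ell2 \<Rightarrow> real" where
  "norm_ell2 x = sqrt (inner x x)"

definition dist_ell2 :: "'a ell2 \<Rightarrow> 'a ell2 \<Rightarrow> real" where
  "dist_ell2 x y = norm (x - y)"

definition sgn_ell2 :: "'a ell2 \<Rightarrow> 'a ell2" where
  "sgn_ell2 x = inverse (norm x) *\<^sub>R x"

definition uniformity_ell2 :: "('a ell2 \<times> 'a ell2) filter" where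
  "uniformity_ell2 = (INF e\<in>{0<..}. principal {(x, y). dist x y < e})"

definition open_ell2 :: "'a ell2 set \<Rightarrow> bool" where
  "open_ell2 U = (\<forall>x\<in>U. \<forall>\<^sub>F (x', y) in uniformity. x' = x \<longrightarrow> y \<in> U)"

instance
proof
  fix x y z :: "'a ell2" and a b c :: real
  note coord_simps = zero_ell2.rep_eq plus_ell2.rep_eq scaleR_ell2.rep_eq uminus_ell2.rep_eq
  note summable = ell_two_summable_mult[OF coord coord]
  show "x + y + z = x + (y + z)" "x + y = y + x" "0 + x = x" "- x + x = 0"
    "x - y = x + - y" "a *\<^sub>R (x + y) = a *\<^sub>R x + a *\<^sub>R y"
    "(a + b) *\<^sub>R x = a *\<^sub>R x + b *\<^sub>R x" "a *\<^sub>R b *\<^sub>R x = (a * b) *\<^sub>R x" "1 *\<^sub>R x = x"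
    by (rule ell2_eqI; simp add: minus_ell2_def coord_simps algebra_simps)+
  show "dist x y = norm (x - y)"
    by (rule dist_ell2_def)
  show "sgn x = inverse (norm x) *\<^sub>R x"
    by (rule sgn_ell2_def)
  show "(uniformity :: ('a ell2 \<times> 'a ell2) filter) =
      (INF e\<in>{0<..}. principal {(x, y). dist x y < e})"
    by (rule uniformity_ell2_def)
  show "open U = (\<forall>x\<in>U. \<forall>\<^sub>F (x', y) in uniformity. x' = x \<longrightarrow> y \<in> U)" for U :: "'a ell2 set"
    by (rule open_ell2_def)
  show "inner x y = inner y x"
    by (simp add: inner_ell2_def mult.commute)
  show "inner (x + y) z = inner x z + inner y z"
    by (simp add: inner_ell2_def coord_simps distrib_right infsum_add summable)
  show "inner (c *\<^sub>R x) y = c * inner x y"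
    by (simp add: inner_ell2_def coord_simps mult.assoc infsum_cmult_right')
  show "0 \<le> inner x x"
    by (simp add: inner_ell2_def infsum_nonneg)
  show "inner x x = 0 \<longleftrightarrow> x = 0"
  proof
    assume "inner x x = 0"
    then have "coord x i * coord x i = 0" for i
      unfolding inner_ell2_def by (intro nonneg_infsum_le_0D[where A = UNIV]) (simp_all add: summable)
    then show "x = 0"
      by (intro ell2_eqI) (simp add: coord_simps)
  next
    assume "x = 0"
    then show "inner x x = 0"
      by (simp add: inner_ell2_def coord_simps)
  qed
  show "norm x = sqrt (inner x x)"
    by (rule norm_ell2_def)
qed

end

lemma norm_ell2_eq_ell_norm: "norm x = ell_norm 2 (coord x)"
  by (simp add: norm_ell2_def inner_ell2_def ell_norm_def powr_half_sqrt infsum_nonneg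
      flip: power2_eq_square)

definition weakly_tendsto :: "(nat \<Rightarrow> 'a::real_normed_vector) \<Rightarrow> 'a \<Rightarrow> bool" where
  "weakly_tendsto x l \<longleftrightarrow> (\<forall>f :: 'a \<Rightarrow> real. bounded_linear f \<longrightarrow> (\<lambda>n. f (x n)) \<longlonglongrightarrow> f l)"


section \<open>The functional, its surrogates and the alternating algorithm\<close>

text \<open>The membership test on \<open>v\<close> holds automatically for \<open>q \<ge> 2\<close>, since then
  \<open>\<ell>\<^sub>2 \<subseteq> \<ell>\<^sub>q\<close>; it only gives the functional its intended value \<open>\<infinity>\<close> for smaller \<open>q\<close>.\<close>

definition J ::
  "('i ell2 \<Rightarrow> 'h::real_inner) \<Rightarrow> 'h \<Rightarrow> real \<Rightarrow> real \<Rightarrow> real \<Rightarrow> real \<Rightarrow> real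
    \<Rightarrow> 'i ell2 \<Rightarrow> 'i ell2 \<Rightarrow> ereal" where
  "J T y \<alpha> \<beta> \<epsilon> p q u v =
    (if coord u \<in> ell p \<and> coord v \<in> ell q
     then ereal ((norm (T (u + v) - y))\<^sup>2 + \<alpha> * ell_norm p (coord u) powr p
       + (\<beta> * ell_norm q (coord v) powr q + \<epsilon> * (norm v)\<^sup>2))
     else \<infinity>)"

definition surrogate_u ::
  "('i ell2 \<Rightarrow> 'h::real_inner) \<Rightarrow> 'h \<Rightarrow> real \<Rightarrow> real \<Rightarrow> real \<Rightarrow> real \<Rightarrow> real
    \<Rightarrow> 'i ell2 \<Rightarrow> 'i ell2 \<Rightarrow> 'i ell2 \<Rightarrow> ereal" where
  "surrogate_u T y \<alpha> \<beta> \<epsilon> p q u v a =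
    J T y \<alpha> \<beta> \<epsilon> p q u v + ereal ((norm (u - a))\<^sup>2) - ereal ((norm (T u - T a))\<^sup>2)"

definition surrogate_v ::
  "('i ell2 \<Rightarrow> 'h::real_inner) \<Rightarrow> 'h \<Rightarrow> real \<Rightarrow> real \<Rightarrow> real \<Rightarrow> real \<Rightarrow> real
    \<Rightarrow> 'i ell2 \<Rightarrow> 'i ell2 \<Rightarrow> 'i ell2 \<Rightarrow> ereal" where
  "surrogate_v T y \<alpha> \<beta> \<epsilon> p q u v a =
    J T y \<alpha> \<beta> \<epsilon> p q u v + ereal ((norm (v - a))\<^sup>2) - ereal ((norm (T v - T a))\<^sup>2)"

text \<open>\<open>ui n l\<close> and \<open>vi n l\<close> are the inner iterates \<open>u\<^bsup>(n,l)\<^esup>\<close> and \<open>v\<^bsup>(n,l)\<^esup>\<close>; only their values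
  for \<open>n \<ge> 1\<close> with \<open>l \<le> L\<close> and \<open>l \<le> M\<close>, respectively, are constrained.\<close>

definition alternating_algorithm ::
  "('i ell2 \<Rightarrow> 'h::real_inner) \<Rightarrow> 'h \<Rightarrow> real \<Rightarrow> real \<Rightarrow> real \<Rightarrow> real \<Rightarrow> real
    \<Rightarrow> nat \<Rightarrow> nat \<Rightarrow> (nat \<Rightarrow> 'i ell2) \<Rightarrow> (nat \<Rightarrow> 'i ell2) \<Rightarrow> bool" where
  "alternating_algorithm T y \<alpha> \<beta> \<epsilon> p q L M u v \<longleftrightarrow>
    (\<exists>ui vi. \<forall>n.
      ui (Suc n) 0 = u n \<and>
      (\<forall>l<L. is_arg_min (\<lambda>w. surrogate_u T y \<alpha> \<beta> \<epsilon> p q w (v n) (ui (Suc n) l))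
        (\<lambda>_. True) (ui (Suc n) (Suc l))) \<and>
      u (Suc n) = ui (Suc n) L \<and>
      vi (Suc n) 0 = v n \<and>
      (\<forall>l<M. is_arg_min (\<lambda>w. surrogate_v T y \<alpha> \<beta> \<epsilon> p q (u (Suc n)) w (vi (Suc n) l))
        (\<lambda>_. True) (vi (Suc n) (Suc l))) \<and>
      v (Suc n) = vi (Suc n) M)"

end

theory Submission
  imports Defs
begin

text \<open>
  The term \<open>- \<parallel>T u - T a\<parallel>\<^sup>2\<close> in a surrogate cancels the quadratic part of the data misfit, so that
  what remains couples \<open>u\<close> to \<open>T\<close> only through a linear functional. With the adjoint \<open>S\<close> of \<open>T\<close> and
  \<open>b = a - S (T a + T v - y)\<close>, the surrogate is, up to a constant,
  \<open>\<Sum>i. (u\<^sub>i - b\<^sub>i)\<^sup>2 + \<phi>(u\<^sub>i)\<close> with \<open>\<phi>(t) = \<alpha> \<bar>t\<bar>\<^sup>p\<close>. It is therefore minimized exactly by those \<open>u\<close>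
  whose every coordinate minimizes its own scalar function (\<open>block_surrogate_minimal_iff\<close>). The same
  holds with the blocks exchanged and \<open>\<phi>\<close> replaced by \<open>\<psi>(t) = \<beta> \<bar>t\<bar>\<^sup>q + \<epsilon> t\<^sup>2\<close>. Everything about a
  single block is hence proved for an arbitrary penalty profile and used twice.

  The scalar conditions survive weak limits, however nonconvex \<open>\<phi>\<close> may be: under weak convergence
  of \<open>a\<close> and \<open>v\<close> each single coordinate of \<open>b\<close> converges, and \<open>\<phi>\<close> is continuous
  (\<open>block_minimal_weak_limit\<close>). It remains to see that, along the subsequence, the anchor \<open>a\<close> and
  the fixed block from which an iterate is computed have the same weak limits as the iterates.
  This is so because \<open>\<parallel>T\<parallel> < 1\<close> makes each surrogate step lower the functional by at least
  \<open>(1 - \<parallel>T\<parallel>\<^sup>2)\<close> times its squared length (\<open>block_descent\<close>); the functional is bounded below, so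
  all step lengths tend to 0 (\<open>alternating_steps_vanish\<close>).
\<close>

section \<open>Coordinates, Riesz representation and adjoints in \<open>\<ell>\<^sub>2\<close>\<close>

lemmas coord_simps = zero_ell2.rep_eq plus_ell2.rep_eq scaleR_ell2.rep_eq uminus_ell2.rep_eq

lift_definition unit_ell2 :: "'i \<Rightarrow> 'i ell2" is "\<lambda>i j. if j = i then 1 else 0"
proof -
  fix i :: 'i
  have "(\<lambda>j. (if j = i then 1 else 0::real)\<^sup>2) summable_on {i}"
    by simp
  then show "(\<lambda>j. if j = i then 1 else 0) \<in> ell 2"
    unfolding ell_two_iff
    by (rule summable_on_cong_neutral[THEN iffD1, rotated 3]) auto
qed

lemma inner_unit_ell2: "inner x (unit_ell2 i) = coord x i"
proof -
  have "inner x (unit_ell2 i) = (\<Sum>\<^sub>\<infinity>j\<in>{i}. coord x j)"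
    unfolding inner_ell2_def by (rule infsum_cong_neutral) (auto simp: unit_ell2.rep_eq)
  then show ?thesis
    by simp
qed

lemma bounded_linear_coord: "bounded_linear (\<lambda>x. coord x i)"
  using bounded_linear_inner_left[of "unit_ell2 i"] by (simp add: inner_unit_ell2)

lemma coord_sum: "coord (\<Sum>k\<in>F. g k) i = (\<Sum>k\<in>F. coord (g k) i)"
  using linear_sum[OF bounded_linear.linear[OF bounded_linear_coord[of i]], of g F] by simp

lemma coord_minus: "coord (x - y) i = coord x i - coord y i"
  by (rule linear_diff[OF bounded_linear.linear[OF bounded_linear_coord]])

lemma inner_ell2_has_sum: "((\<lambda>i. coord x i * coord y i) has_sum inner x y) UNIV"
  unfolding inner_ell2_def by (intro has_sum_infsum ell_two_summable_mult coord)

lemma norm_ell2_has_sum: "((\<lambda>i. (coord x i)\<^sup>2) has_sum (norm x)\<^sup>2) UNIV"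
  using inner_ell2_has_sum[of x x] by (simp add: power2_eq_square flip: power2_norm_eq_inner)

lemma norm_sum_unit_ell2:
  assumes "finite F"
  shows "(norm (\<Sum>i\<in>F. c i *\<^sub>R unit_ell2 i))\<^sup>2 = (\<Sum>i\<in>F. (c i)\<^sup>2)"
proof -
  let ?x = "\<Sum>i\<in>F. c i *\<^sub>R unit_ell2 i"
  have "coord ?x i = c i" if "i \<in> F" for i
    using assms that
    by (simp add: coord_sum coord_simps unit_ell2.rep_eq if_distrib[of "\<lambda>x. _ * x"] cong: if_cong)
  then have "inner ?x ?x = (\<Sum>i\<in>F. c i * c i)"
    by (simp add: inner_sum_right[of ?x] inner_unit_ell2)
  then show ?thesis
    by (simp add: power2_norm_eq_inner power2_eq_square[of "c _"])
qed

text \<open>The tail of the expansion has squared norm \<open>\<parallel>x\<parallel>\<^sup>2 - (\<Sum>i\<in>F. x\<^sub>i\<^sup>2)\<close>, by orthogonality.\<close>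

lemma sum_unit_ell2_tendsto:
  "((\<lambda>F. \<Sum>i\<in>F. coord x i *\<^sub>R unit_ell2 i) \<longlongrightarrow> x) (finite_subsets_at_top UNIV)"
proof -
  have eq: "(norm ((\<Sum>i\<in>F. coord x i *\<^sub>R unit_ell2 i) - x))\<^sup>2 = (norm x)\<^sup>2 - (\<Sum>i\<in>F. (coord x i)\<^sup>2)"
    if "finite F" for F
  proof -
    let ?s = "\<Sum>i\<in>F. coord x i *\<^sub>R unit_ell2 i"
    have "inner x ?s = (\<Sum>i\<in>F. (coord x i)\<^sup>2)"
      by (simp add: inner_sum_right inner_unit_ell2 power2_eq_square)
    moreover have "inner ?s ?s = (\<Sum>i\<in>F. (coord x i)\<^sup>2)"
      using norm_sum_unit_ell2[OF that] by (simp add: power2_norm_eq_inner)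
    ultimately show ?thesis
      by (simp add: power2_norm_eq_inner inner_diff_left inner_diff_right inner_commute)
  qed
  have "((\<lambda>F. (norm x)\<^sup>2 - (\<Sum>i\<in>F. (coord x i)\<^sup>2)) \<longlongrightarrow> (norm x)\<^sup>2 - (norm x)\<^sup>2)
      (finite_subsets_at_top UNIV)"
    using norm_ell2_has_sum[of x] unfolding has_sum_def by (intro tendsto_intros)
  moreover have "eventually (\<lambda>F. (norm x)\<^sup>2 - (\<Sum>i\<in>F. (coord x i)\<^sup>2)
      = (norm ((\<Sum>i\<in>F. coord x i *\<^sub>R unit_ell2 i) - x))\<^sup>2) (finite_subsets_at_top UNIV)"
    by (rule eventually_finite_subsets_at_top_weakI) (simp add: eq)
  ultimately have "((\<lambda>F. (norm ((\<Sum>i\<in>F. coord x i *\<^sub>R unit_ell2 i) - x))\<^sup>2) \<longlongrightarrow> 0)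
      (finite_subsets_at_top UNIV)"
    by (simp add: tendsto_cong)
  then have "((\<lambda>F. norm ((\<Sum>i\<in>F. coord x i *\<^sub>R unit_ell2 i) - x)) \<longlongrightarrow> 0)
      (finite_subsets_at_top UNIV)"
    using tendsto_real_sqrt by fastforce
  then show ?thesis
    by (metis LIM_zero_cancel tendsto_norm_zero_iff)
qed

text \<open>The representing vector must have coordinates \<open>g\<^sub>i = f e\<^sub>i\<close>. It is square summable because
  testing \<open>f\<close> on \<open>\<Sum>i\<in>F. g\<^sub>i e\<^sub>i\<close>, a vector of squared norm \<open>\<Sum>i\<in>F. g\<^sub>i\<^sup>2\<close>, bounds that sum by
  \<open>\<parallel>f\<parallel>\<^sup>2\<close>. Density of the finitely supported vectors does the rest.\<close>

lemma ell2_riesz: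
  fixes f :: "'i ell2 \<Rightarrow> real"
  assumes f: "bounded_linear f"
  obtains b where "\<And>x. f x = inner x b"
proof -
  interpret bounded_linear f by (rule f)
  define g where "g i = f (unit_ell2 i)" for i
  have f_sum: "f (\<Sum>i\<in>F. c i *\<^sub>R unit_ell2 i) = (\<Sum>i\<in>F. c i * g i)" for F c
    by (simp add: sum scaleR g_def)
  have bound: "(\<Sum>i\<in>F. (g i)\<^sup>2) \<le> (onorm f)\<^sup>2" if "finite F" for F
  proof -
    let ?x = "\<Sum>i\<in>F. g i *\<^sub>R unit_ell2 i"
    have n: "(norm ?x)\<^sup>2 = f ?x"
      using norm_sum_unit_ell2[OF that, of g] by (simp add: f_sum power2_eq_square[of "g _"])
    also have "\<dots> \<le> onorm f * norm ?x"
      using onorm[OF f, of ?x] by simp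
    finally have "norm ?x \<le> onorm f"
      by (cases "norm ?x = 0") (auto simp: power2_eq_square onorm_pos_le[OF f])
    then have "(norm ?x)\<^sup>2 \<le> (onorm f)\<^sup>2"
      by (intro power_mono) auto
    then show ?thesis
      using that by (simp add: norm_sum_unit_ell2)
  qed
  have "(\<lambda>i. (g i)\<^sup>2) summable_on UNIV"
    by (rule nonneg_bdd_above_summable_on) (use bound in \<open>auto intro!: bdd_aboveI\<close>)
  then have b: "coord (Abs_ell2 g) = g"
    by (intro Abs_ell2_inverse) (simp add: ell_two_iff)
  have "f x = inner x (Abs_ell2 g)" for x
  proof (rule tendsto_unique[OF finite_subsets_at_top_neq_bot])
    show "((\<lambda>F. \<Sum>i\<in>F. coord x i * g i) \<longlongrightarrow> f x) (finite_subsets_at_top UNIV)"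
      using tendsto[OF sum_unit_ell2_tendsto[of x]] by (simp add: f_sum)
    show "((\<lambda>F. \<Sum>i\<in>F. coord x i * g i) \<longlongrightarrow> inner x (Abs_ell2 g)) (finite_subsets_at_top UNIV)"
      using inner_ell2_has_sum[of x "Abs_ell2 g"] by (simp add: has_sum_def b)
  qed
  then show ?thesis
    by (rule that)
qed

text \<open>The value \<open>S h\<close> represents the functional \<open>\<lambda>x. T x \<bullet> h\<close>.\<close>

lemma ell2_adjoint:
  fixes T :: "'i ell2 \<Rightarrow> 'h::real_inner"
  assumes "bounded_linear T"
  obtains S where "\<And>x h. inner (T x) h = inner x (S h)"
proof -
  have "\<exists>b. \<forall>x. inner (T x) h = inner x b" for h
    using ell2_riesz[OF bounded_linear_inner_left_comp[OF assms, of h]] by blast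
  then show ?thesis
    using that by metis
qed

section \<open>Separable penalized quadratics\<close>

definition penalty :: "(real \<Rightarrow> real) \<Rightarrow> 'i ell2 \<Rightarrow> ereal" where
  "penalty \<phi> x =
    (if (\<lambda>i. \<phi> (coord x i)) summable_on UNIV then ereal (\<Sum>\<^sub>\<infinity>i. \<phi> (coord x i)) else \<infinity>)"

lemma penalty_nonneg: "(\<And>t. 0 \<le> \<phi> t) \<Longrightarrow> 0 \<le> penalty \<phi> x"
  by (simp add: penalty_def infsum_nonneg)

lemma penalty_0: "\<phi> 0 = 0 \<Longrightarrow> penalty \<phi> 0 = 0"
  by (simp add: penalty_def coord_simps)

text \<open>Changing one coordinate of \<open>x\<close> changes the functional by the change of the corresponding scalar
  function. This difference is meaningful because the penalty of a minimizer is finite, the value at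
  0 being finite.\<close>

lemma coordinatewise_minimal_if_minimal:
  assumes zero: "\<phi> 0 = 0"
    and min: "\<And>w. penalty \<phi> x + ereal ((norm x)\<^sup>2 - 2 * inner x b)
      \<le> penalty \<phi> w + ereal ((norm w)\<^sup>2 - 2 * inner w b)"
  shows "\<phi> (coord x i) + (coord x i)\<^sup>2 - 2 * coord x i * coord b i
    \<le> \<phi> t + t\<^sup>2 - 2 * t * coord b i"
proof -
  let ?d = "t - coord x i"
  define w where "w = x + ?d *\<^sub>R unit_ell2 i"
  have w: "coord w j = (if j = i then t else coord x j)" for j
    by (simp add: w_def coord_simps unit_ell2.rep_eq)
  have "penalty \<phi> x \<noteq> \<infinity>"
    using min[of 0] by (auto simp: penalty_0[of \<phi>] zero)
  then have sx: "(\<lambda>j. \<phi> (coord x j)) summable_on UNIV"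
    by (auto simp: penalty_def split: if_splits)
  then have hx: "((\<lambda>j. \<phi> (coord x j)) has_sum (\<Sum>\<^sub>\<infinity>j. \<phi> (coord x j))) UNIV"
    by (rule has_sum_infsum)
  have "((\<lambda>j. (if j = i then \<phi> t - \<phi> (coord x i) else 0)) has_sum (\<phi> t - \<phi> (coord x i))) UNIV"
    by (rule has_sum_finite_neutralI[of "{i}"]) auto
  from has_sum_add[OF hx this]
  have "((\<lambda>j. \<phi> (coord w j)) has_sum (\<Sum>\<^sub>\<infinity>j. \<phi> (coord x j)) + (\<phi> t - \<phi> (coord x i))) UNIV"
    by (rule has_sum_cong[THEN iffD1, rotated]) (auto simp: w)
  then have pw: "penalty \<phi> w = ereal ((\<Sum>\<^sub>\<infinity>j. \<phi> (coord x j)) + (\<phi> t - \<phi> (coord x i)))"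
    by (auto simp: penalty_def infsumI dest: has_sum_imp_summable)
  have unit: "inner x (unit_ell2 i) = coord x i" "inner (unit_ell2 i) x = coord x i"
    "inner (unit_ell2 i) (unit_ell2 i) = 1" "inner (unit_ell2 i) b = coord b i"
    by (simp_all add: inner_unit_ell2 inner_commute[of "unit_ell2 i" x]
        inner_commute[of "unit_ell2 i" b] unit_ell2.rep_eq)
  have "(norm w)\<^sup>2 = (norm x)\<^sup>2 + 2 * ?d * coord x i + ?d\<^sup>2"
    unfolding power2_norm_eq_inner w_def inner_add_left inner_add_right inner_scaleR_left
      inner_scaleR_right unit by (simp add: algebra_simps power2_eq_square)
  moreover have "inner w b = inner x b + ?d * coord b i"
    unfolding w_def inner_add_left inner_scaleR_left unit by simp
  ultimately have "(norm x)\<^sup>2 - 2 * inner x b \<le>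
      \<phi> t - \<phi> (coord x i) + ((norm x)\<^sup>2 + 2 * ?d * coord x i + ?d\<^sup>2 - 2 * (inner x b + ?d * coord b i))"
    using min[of w] sx unfolding pw by (simp add: penalty_def)
  then show ?thesis
    by (simp add: algebra_simps power2_eq_square)
qed

text \<open>Conversely, the scalar inequalities are summed over all coordinates. Comparison with \<open>t = 0\<close> first
  gives \<open>\<phi>(x\<^sub>i) \<le> 2 x\<^sub>i b\<^sub>i - x\<^sub>i\<^sup>2\<close>, whose right-hand side is summable; so the penalty of \<open>x\<close> is
  finite.\<close>

lemma minimal_if_coordinatewise_minimal:
  assumes nonneg: "\<And>t. 0 \<le> \<phi> t" and zero: "\<phi> 0 = 0"
    and min: "\<And>i t. \<phi> (coord x i) + (coord x i)\<^sup>2 - 2 * coord x i * coord b i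
      \<le> \<phi> t + t\<^sup>2 - 2 * t * coord b i"
  shows "penalty \<phi> x + ereal ((norm x)\<^sup>2 - 2 * inner x b)
    \<le> penalty \<phi> w + ereal ((norm w)\<^sup>2 - 2 * inner w b)"
proof (cases "(\<lambda>i. \<phi> (coord w i)) summable_on UNIV")
  case False
  then show ?thesis
    by (simp add: penalty_def)
next
  case True
  have quad: "((\<lambda>i. (coord a i)\<^sup>2 - 2 * (coord a i * coord b i)) has_sum
      (norm a)\<^sup>2 - 2 * inner a b) UNIV" for a
    using has_sum_add[OF norm_ell2_has_sum has_sum_cmult_right[OF inner_ell2_has_sum], of a "-2" a b]
    by simp
  have total: "((\<lambda>i. \<phi> (coord a i) + ((coord a i)\<^sup>2 - 2 * (coord a i * coord b i))) has_sum
      (\<Sum>\<^sub>\<infinity>i. \<phi> (coord a i)) + ((norm a)\<^sup>2 - 2 * inner a b)) UNIV"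
    if "(\<lambda>i. \<phi> (coord a i)) summable_on UNIV" for a
    by (intro has_sum_add quad has_sum_infsum that)
  have "(\<lambda>i. - ((coord x i)\<^sup>2 - 2 * (coord x i * coord b i))) summable_on UNIV"
    unfolding summable_on_uminus by (rule has_sum_imp_summable[OF quad])
  then have sx: "(\<lambda>i. \<phi> (coord x i)) summable_on UNIV"
  proof (rule summable_on_comparison_test)
    show "\<phi> (coord x i) \<le> - ((coord x i)\<^sup>2 - 2 * (coord x i * coord b i))" for i
      using min[of i 0] by (simp add: zero)
  qed (rule nonneg)
  have "(\<Sum>\<^sub>\<infinity>i. \<phi> (coord x i)) + ((norm x)\<^sup>2 - 2 * inner x b)
      \<le> (\<Sum>\<^sub>\<infinity>i. \<phi> (coord w i)) + ((norm w)\<^sup>2 - 2 * inner w b)"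
  proof (rule has_sum_mono[OF total[OF sx] total[OF True]])
    show "\<phi> (coord x i) + ((coord x i)\<^sup>2 - 2 * (coord x i * coord b i))
        \<le> \<phi> (coord w i) + ((coord w i)\<^sup>2 - 2 * (coord w i * coord b i))" for i
      using min[of i "coord w i"] by (simp add: mult.assoc)
  qed
  with sx True show ?thesis
    by (simp add: penalty_def)
qed

section \<open>Surrogates for one block\<close>

text \<open>The functional and its surrogate, seen from the block \<open>x\<close> that is being updated while \<open>z\<close> is kept
  fixed. Exchanging \<open>\<phi>\<close> with \<open>\<psi>\<close> and \<open>x\<close> with \<open>z\<close> passes from one block to the other.\<close>

definition block_objective ::
  "('i ell2 \<Rightarrow> 'h::real_inner) \<Rightarrow> 'h \<Rightarrow> (real \<Rightarrow> real) \<Rightarrow> (real \<Rightarrow> real)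
    \<Rightarrow> 'i ell2 \<Rightarrow> 'i ell2 \<Rightarrow> ereal" where
  "block_objective T y \<phi> \<psi> x z =
    ereal ((norm (T (x + z) - y))\<^sup>2) + penalty \<phi> x + penalty \<psi> z"

definition block_surrogate ::
  "('i ell2 \<Rightarrow> 'h::real_inner) \<Rightarrow> 'h \<Rightarrow> (real \<Rightarrow> real) \<Rightarrow> (real \<Rightarrow> real)
    \<Rightarrow> 'i ell2 \<Rightarrow> 'i ell2 \<Rightarrow> 'i ell2 \<Rightarrow> ereal" where
  "block_surrogate T y \<phi> \<psi> x z a =
    block_objective T y \<phi> \<psi> x z + ereal ((norm (x - a))\<^sup>2) - ereal ((norm (T x - T a))\<^sup>2)"

lemma block_objective_commute: "block_objective T y \<phi> \<psi> x z = block_objective T y \<psi> \<phi> z x"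
  by (simp add: block_objective_def add.commute add.left_commute)

text \<open>The terms \<open>\<parallel>T x\<parallel>\<^sup>2\<close> of the misfit and of the surrogate correction cancel. What is left is
  quadratic in \<open>x\<close> without any coupling between coordinates.\<close>

lemma block_surrogate_separates:
  fixes T :: "'i ell2 \<Rightarrow> 'h::real_inner"
  assumes "linear T" and S: "\<And>x h. inner (T x) h = inner x (S h)"
  shows "block_surrogate T y \<phi> \<psi> x z a =
    penalty \<phi> x + ereal ((norm x)\<^sup>2 - 2 * inner x (a - S (T a + T z - y)))
      + (ereal ((norm a)\<^sup>2 + (norm (T z - y))\<^sup>2 - (norm (T a))\<^sup>2) + penalty \<psi> z)"
proof -
  have "(norm (T (x + z) - y))\<^sup>2 + (norm (x - a))\<^sup>2 - (norm (T x - T a))\<^sup>2 =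
      (norm x)\<^sup>2 - 2 * inner x (a - S (T a + T z - y))
        + ((norm a)\<^sup>2 + (norm (T z - y))\<^sup>2 - (norm (T a))\<^sup>2)"
    by (simp add: inner_diff_right[of x] S[symmetric] linear_add[OF assms(1)] power2_norm_eq_inner
        inner_diff_left inner_diff_right inner_add_left inner_add_right inner_commute algebra_simps)
  then have "block_surrogate T y \<phi> \<psi> x z a = ereal ((norm x)\<^sup>2 - 2 * inner x (a - S (T a + T z - y))
        + ((norm a)\<^sup>2 + (norm (T z - y))\<^sup>2 - (norm (T a))\<^sup>2)) + penalty \<phi> x + penalty \<psi> z"
    unfolding block_surrogate_def block_objective_def
    by (cases "penalty \<phi> x"; cases "penalty \<psi> z") (auto simp: algebra_simps)
  then show ?thesis
    by (cases "penalty \<phi> x"; cases "penalty \<psi> z") (auto simp: algebra_simps)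
qed


lemma block_surrogate_minimal_iff:
  fixes T :: "'i ell2 \<Rightarrow> 'h::real_inner"
  assumes "linear T" and "\<And>x h. inner (T x) h = inner x (S h)"
    and nonneg: "\<And>t. 0 \<le> \<phi> t" and zero: "\<phi> 0 = 0" and z: "penalty \<psi> z \<noteq> \<infinity>"
  shows "(\<forall>w. block_surrogate T y \<phi> \<psi> x z a \<le> block_surrogate T y \<phi> \<psi> w z a) \<longleftrightarrow>
    (\<forall>i t. \<phi> (coord x i) + (coord x i)\<^sup>2 - 2 * coord x i * coord (a - S (T a + T z - y)) i
      \<le> \<phi> t + t\<^sup>2 - 2 * t * coord (a - S (T a + T z - y)) i)"
proof -
  define b where "b = a - S (T a + T z - y)"
  define K where "K = ereal ((norm a)\<^sup>2 + (norm (T z - y))\<^sup>2 - (norm (T a))\<^sup>2) + penalty \<psi> z"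
  have K: "\<bar>K\<bar> \<noteq> \<infinity>"
    using z by (auto simp: K_def penalty_def split: if_splits)
  have "block_surrogate T y \<phi> \<psi> x z a \<le> block_surrogate T y \<phi> \<psi> w z a \<longleftrightarrow>
      penalty \<phi> x + ereal ((norm x)\<^sup>2 - 2 * inner x b)
        \<le> penalty \<phi> w + ereal ((norm w)\<^sup>2 - 2 * inner w b)" for w
    unfolding block_surrogate_separates[OF assms(1,2)] b_def[symmetric] K_def[symmetric]
    using K by (cases K) (auto simp: ereal_add_le_add_iff2)
  then show ?thesis
    using coordinatewise_minimal_if_minimal[of \<phi> x b, OF zero]
      minimal_if_coordinatewise_minimal[of \<phi> x b, OF nonneg zero]
    unfolding b_def[symmetric] by blast
qed

lemma penalty_finite_if_block_minimal:
  assumes "\<phi> 0 = 0" and "penalty \<psi> z \<noteq> \<infinity>"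
    and "\<And>w. block_surrogate T y \<phi> \<psi> x z a \<le> block_surrogate T y \<phi> \<psi> w z a"
  shows "penalty \<phi> x \<noteq> \<infinity>"
proof
  assume "penalty \<phi> x = \<infinity>"
  then have "block_surrogate T y \<phi> \<psi> x z a = \<infinity>"
    by (simp add: block_surrogate_def block_objective_def penalty_def)
  moreover have "block_surrogate T y \<phi> \<psi> 0 z a \<noteq> \<infinity>"
    using assms(2) by (cases "penalty \<psi> z")
      (simp_all add: block_surrogate_def block_objective_def penalty_0[of \<phi>, OF assms(1)])
  ultimately show False
    using assms(3)[of 0] by simp
qed

section \<open>Weak limits of surrogate minimizers\<close>

lemma weakly_tendstoD:
  fixes f :: "'a::real_normed_vector \<Rightarrow> real"
  shows "weakly_tendsto x l \<Longrightarrow> bounded_linear f \<Longrightarrow> (\<lambda>n. f (x n)) \<longlonglongrightarrow> f l"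
  by (simp add: weakly_tendsto_def)

lemmas weakly_tendsto_ell2_coord = weakly_tendstoD[OF _ bounded_linear_coord]

lemma weakly_tendsto_Suc:
  assumes "weakly_tendsto x l"
  shows "weakly_tendsto (\<lambda>n. x (Suc n)) l"
  unfolding weakly_tendsto_def
proof (intro allI impI)
  fix f :: "'a \<Rightarrow> real"
  assume "bounded_linear f"
  with assms have "(\<lambda>n. f (x n)) \<longlonglongrightarrow> f l"
    by (rule weakly_tendstoD)
  then show "(\<lambda>n. f (x (Suc n))) \<longlonglongrightarrow> f l"
    by (rule LIMSEQ_Suc)
qed

lemma weakly_tendsto_diff_null:
  fixes x y :: "nat \<Rightarrow> 'a::real_normed_vector"
  assumes "weakly_tendsto x l" and null: "(\<lambda>n. x n - y n) \<longlonglongrightarrow> 0"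
  shows "weakly_tendsto y l"
  unfolding weakly_tendsto_def
proof (intro allI impI)
  fix f :: "'a \<Rightarrow> real"
  assume f: "bounded_linear f"
  then interpret bounded_linear f .
  have "(\<lambda>n. f (x n) - f (x n - y n)) \<longlonglongrightarrow> f l - f 0"
    by (intro tendsto_diff weakly_tendstoD[OF assms(1) f] tendsto[OF null])
  then show "(\<lambda>n. f (y n)) \<longlonglongrightarrow> f l"
    by (simp add: diff zero)
qed

text \<open>For nonconvex \<open>\<phi>\<close> weak lower semicontinuity by convexity is no way to the limit. The
  coordinatewise description of minimality is: coordinates are weakly continuous, and so are the coordinates
  of \<open>b = a - S (T a + T z - y)\<close>, since \<open>b\<^sub>i = a\<^sub>i - T e\<^sub>i \<bullet> (T a + T z - y)\<close>.\<close>

lemma block_minimal_weak_limit: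
  fixes T :: "'i ell2 \<Rightarrow> 'h::real_inner"
  assumes T: "bounded_linear T"
    and nonneg: "\<And>t. 0 \<le> \<phi> t" and zero: "\<phi> 0 = 0" and cont: "continuous_on UNIV \<phi>"
    and min: "\<And>n w. block_surrogate T y \<phi> \<psi> (x n) (z n) (a n)
      \<le> block_surrogate T y \<phi> \<psi> w (z n) (a n)"
    and fin: "\<And>n. penalty \<psi> (z n) \<noteq> \<infinity>"
    and x: "weakly_tendsto x x'" and a: "weakly_tendsto a x'" and z: "weakly_tendsto z z'"
  shows "block_surrogate T y \<phi> \<psi> x' z' x' \<le> block_surrogate T y \<phi> \<psi> w z' x'"
proof (cases "penalty \<psi> z' = \<infinity>")
  case True
  \<comment> \<open>Then the surrogate is infinite everywhere and every point is a minimizer.\<close>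
  then show ?thesis
    by (simp add: block_surrogate_def block_objective_def penalty_def)
next
  case False
  obtain S where S: "\<And>x h. inner (T x) h = inner x (S h)"
    using ell2_adjoint[OF T] by blast
  note iff = block_surrogate_minimal_iff[where T = T and S = S and \<phi> = \<phi>,
      OF bounded_linear.linear[OF T] S nonneg zero]
  define b where "b a z = a - S (T a + T z - y)" for a z
  have b: "(\<lambda>n. coord (b (a n) (z n)) i) \<longlonglongrightarrow> coord (b x' z') i" for i
  proof -
    let ?h = "T (unit_ell2 i)"
    have eq: "coord (b a z) i = coord a i - (inner ?h (T a) + inner ?h (T z) - inner ?h y)" for a z
    proof -
      have "coord (S h) i = inner ?h h" for h
        by (simp add: S inner_commute[of "unit_ell2 i"] inner_unit_ell2)
      then show ?thesis
        by (simp add: b_def coord_minus inner_add_right inner_diff_right)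
    qed
    have "bounded_linear (\<lambda>x. inner ?h (T x))"
      by (rule bounded_linear_compose[OF bounded_linear_inner_right T])
    then have "(\<lambda>n. inner ?h (T (a n))) \<longlonglongrightarrow> inner ?h (T x')"
      "(\<lambda>n. inner ?h (T (z n))) \<longlonglongrightarrow> inner ?h (T z')"
      by (rule weakly_tendstoD[OF a] weakly_tendstoD[OF z]; assumption)+
    then show ?thesis
      unfolding eq by (intro tendsto_diff tendsto_add tendsto_const weakly_tendsto_ell2_coord[OF a])
  qed
  have "\<phi> (coord x' i) + (coord x' i)\<^sup>2 - 2 * coord x' i * coord (b x' z') i
      \<le> \<phi> t + t\<^sup>2 - 2 * t * coord (b x' z') i" for i t
  proof (rule LIMSEQ_le)
    show "(\<lambda>n. \<phi> (coord (x n) i) + (coord (x n) i)\<^sup>2 - 2 * coord (x n) i * coord (b (a n) (z n)) i)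
        \<longlonglongrightarrow> \<phi> (coord x' i) + (coord x' i)\<^sup>2 - 2 * coord x' i * coord (b x' z') i"
      by (intro tendsto_intros b weakly_tendsto_ell2_coord[OF x]
          continuous_on_tendsto_compose[OF cont]) auto
    show "(\<lambda>n. \<phi> t + t\<^sup>2 - 2 * t * coord (b (a n) (z n)) i)
        \<longlonglongrightarrow> \<phi> t + t\<^sup>2 - 2 * t * coord (b x' z') i"
      by (intro tendsto_intros b)
    show "\<exists>N. \<forall>n\<ge>N. \<phi> (coord (x n) i) + (coord (x n) i)\<^sup>2
          - 2 * coord (x n) i * coord (b (a n) (z n)) i
        \<le> \<phi> t + t\<^sup>2 - 2 * t * coord (b (a n) (z n)) i"
      using min iff[OF fin] unfolding b_def by blast
  qed
  then show ?thesis
    using iff[OF False] unfolding b_def by blast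
qed

section \<open>Descent and vanishing steps\<close>

text \<open>The surrogate at \<open>x\<close> exceeds the functional by \<open>\<parallel>x - a\<parallel>\<^sup>2 - \<parallel>T (x - a)\<parallel>\<^sup>2\<close> and agrees with it at
  \<open>x = a\<close>.\<close>

lemma block_descent_step:
  fixes T :: "'i ell2 \<Rightarrow> 'h::real_inner"
  assumes T: "bounded_linear T"
    and min: "\<And>w. block_surrogate T y \<phi> \<psi> x z a \<le> block_surrogate T y \<phi> \<psi> w z a"
  shows "block_objective T y \<phi> \<psi> x z + ereal ((1 - (onorm T)\<^sup>2) * (norm (x - a))\<^sup>2)
    \<le> block_objective T y \<phi> \<psi> a z"
proof -
  have "norm (T x - T a) \<le> onorm T * norm (x - a)"
    using onorm[OF T, of "x - a"] by (simp add: linear_diff[OF bounded_linear.linear[OF T]])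
  then have "(norm (T x - T a))\<^sup>2 \<le> (onorm T * norm (x - a))\<^sup>2"
    by (rule power_mono) simp
  then have "(1 - (onorm T)\<^sup>2) * (norm (x - a))\<^sup>2 \<le> (norm (x - a))\<^sup>2 - (norm (T x - T a))\<^sup>2"
    by (simp add: power_mult_distrib left_diff_distrib)
  then have "block_objective T y \<phi> \<psi> x z + ereal ((1 - (onorm T)\<^sup>2) * (norm (x - a))\<^sup>2)
      \<le> block_surrogate T y \<phi> \<psi> x z a"
    unfolding block_surrogate_def by (cases "block_objective T y \<phi> \<psi> x z") auto
  also have "\<dots> \<le> block_surrogate T y \<phi> \<psi> a z a"
    by (rule min)
  also have "\<dots> = block_objective T y \<phi> \<psi> a z"
    by (simp add: block_surrogate_def flip: zero_ereal_def)
  finally show ?thesis .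
qed

lemma block_descent:
  fixes T :: "'i ell2 \<Rightarrow> 'h::real_inner"
  assumes T: "bounded_linear T"
    and min: "\<And>l w. l < N \<Longrightarrow> block_surrogate T y \<phi> \<psi> (x (Suc l)) z (x l)
      \<le> block_surrogate T y \<phi> \<psi> w z (x l)"
  shows "block_objective T y \<phi> \<psi> (x N) z
      + ereal ((1 - (onorm T)\<^sup>2) * (\<Sum>l<N. (norm (x (Suc l) - x l))\<^sup>2))
    \<le> block_objective T y \<phi> \<psi> (x 0) z"
  using min
proof (induction N)
  case 0
  then show ?case
    by (simp flip: zero_ereal_def)
next
  case (Suc N)
  let ?\<kappa> = "1 - (onorm T)\<^sup>2" and ?s = "\<Sum>l<N. (norm (x (Suc l) - x l))\<^sup>2"
  have "block_objective T y \<phi> \<psi> (x (Suc N)) z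
        + ereal (?\<kappa> * (\<Sum>l<Suc N. (norm (x (Suc l) - x l))\<^sup>2)) =
      block_objective T y \<phi> \<psi> (x (Suc N)) z + ereal (?\<kappa> * (norm (x (Suc N) - x N))\<^sup>2)
        + ereal (?\<kappa> * ?s)"
    by (simp add: distrib_left add.assoc add.commute[of "?\<kappa> * ?s"])
  also have "\<dots> \<le> block_objective T y \<phi> \<psi> (x N) z + ereal (?\<kappa> * ?s)"
    by (intro add_right_mono block_descent_step[OF T] Suc.prems) simp
  also have "\<dots> \<le> block_objective T y \<phi> \<psi> (x 0) z"
    by (intro Suc.IH Suc.prems) simp
  finally show ?case .
qed

lemma descent_tendsto_0:
  fixes E s :: "nat \<Rightarrow> real"
  assumes E: "\<And>n. 0 \<le> E n" and s: "\<And>n. 0 \<le> s n" and descent: "\<And>n. E (Suc n) + s n \<le> E n"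
  shows "s \<longlonglongrightarrow> 0"
proof (rule tendsto_sandwich[of "\<lambda>_. 0" s sequentially "\<lambda>n. E n - E (Suc n)"])
  have "decseq E"
  proof (rule decseq_SucI)
    show "E (Suc n) \<le> E n" for n
      using descent[of n] s[of n] by linarith
  qed
  then obtain e where "E \<longlonglongrightarrow> e"
    using decseq_convergent[of E 0] E by blast
  then have "(\<lambda>n. E n - E (Suc n)) \<longlonglongrightarrow> e - e"
    by (intro tendsto_diff LIMSEQ_Suc)
  then show "(\<lambda>n. E n - E (Suc n)) \<longlonglongrightarrow> 0"
    by simp
  show "eventually (\<lambda>n. 0 \<le> s n) sequentially"
    by (simp add: s)
  show "eventually (\<lambda>n. s n \<le> E n - E (Suc n)) sequentially"
  proof (rule always_eventually, rule allI)
    show "s n \<le> E n - E (Suc n)" for n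
      using descent[of n] by linarith
  qed
qed simp

lemma tendsto_0_if_power2_sum_tendsto_0:
  fixes d :: "nat \<Rightarrow> nat \<Rightarrow> 'a::real_normed_vector"
  assumes "(\<lambda>n. \<Sum>l<N. (norm (d n l))\<^sup>2) \<longlonglongrightarrow> 0" and "l < N"
  shows "(\<lambda>n. d n l) \<longlonglongrightarrow> 0"
proof -
  have "(\<lambda>n. (norm (d n l))\<^sup>2) \<longlonglongrightarrow> 0"
  proof (rule tendsto_sandwich[OF _ _ tendsto_const assms(1)])
    show "eventually (\<lambda>n. (norm (d n l))\<^sup>2 \<le> (\<Sum>l<N. (norm (d n l))\<^sup>2)) sequentially"
      using assms(2) by (intro always_eventually allI member_le_sum) auto
  qed simp
  then have "(\<lambda>n. norm (d n l)) \<longlonglongrightarrow> 0"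
    using tendsto_real_sqrt by fastforce
  then show ?thesis
    by (rule tendsto_norm_zero_cancel)
qed

text \<open>One sweep through both blocks lowers the functional by a multiple of the sum of all squared step
  lengths, and the functional is nonnegative. The starting point may have infinite penalty in \<open>\<phi>\<close>;
  finiteness is required from the first completed sweep on, which is enough for a limit.\<close>

lemma alternating_steps_vanish:
  fixes T :: "'i ell2 \<Rightarrow> 'h::real_inner"
  assumes T: "bounded_linear T" and contr: "onorm T < 1"
    and nonneg: "\<And>t. 0 \<le> \<phi> t" "\<And>t. 0 \<le> \<psi> t"
    and umin: "\<And>n l w. l < L \<Longrightarrow> block_surrogate T y \<phi> \<psi> (ui n (Suc l)) (v n) (ui n l)
      \<le> block_surrogate T y \<phi> \<psi> w (v n) (ui n l)"
    and vmin: "\<And>n l w. l < M \<Longrightarrow> block_surrogate T y \<psi> \<phi> (vi n (Suc l)) (u (Suc n)) (vi n l)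
      \<le> block_surrogate T y \<psi> \<phi> w (u (Suc n)) (vi n l)"
    and ends: "\<And>n. ui n 0 = u n" "\<And>n. ui n L = u (Suc n)"
      "\<And>n. vi n 0 = v n" "\<And>n. vi n M = v (Suc n)"
    and fin: "\<And>n. penalty \<phi> (u (Suc n)) \<noteq> \<infinity>" "\<And>n. penalty \<psi> (v n) \<noteq> \<infinity>"
  shows "l < L \<Longrightarrow> (\<lambda>n. ui n (Suc l) - ui n l) \<longlonglongrightarrow> 0"
    and "l < M \<Longrightarrow> (\<lambda>n. vi n (Suc l) - vi n l) \<longlonglongrightarrow> 0"
proof -
  define \<kappa> where "\<kappa> = 1 - (onorm T)\<^sup>2"
  have "(onorm T)\<^sup>2 < 1\<^sup>2"
    using contr onorm_pos_le[OF T] by (intro power_strict_mono) auto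
  then have \<kappa>: "\<kappa> > 0"
    by (simp add: \<kappa>_def)
  define A where "A n = (\<Sum>l<L. (norm (ui n (Suc l) - ui n l))\<^sup>2)" for n
  define B where "B n = (\<Sum>l<M. (norm (vi n (Suc l) - vi n l))\<^sup>2)" for n
  have nonneg_AB: "0 \<le> A n" "0 \<le> B n" for n
    by (auto simp: A_def B_def intro: sum_nonneg)
  define F where "F n = block_objective T y \<phi> \<psi> (u n) (v n)" for n
  \<comment> \<open>The shift by one skips the initial value, which may be infinite.\<close>
  define E where "E n = real_of_ereal (F (Suc n))" for n
  have F: "F (Suc n) = ereal (E n)" for n
    using fin(1)[of n] fin(2)[of "Suc n"]
    by (auto simp: E_def F_def block_objective_def penalty_def split: if_splits)
  have F_nonneg: "0 \<le> F n" for n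
    by (simp add: F_def block_objective_def penalty_nonneg nonneg)
  have descent: "F (Suc n) + ereal (\<kappa> * B n) + ereal (\<kappa> * A n) \<le> F n" for n
  proof -
    have "F (Suc n) + ereal (\<kappa> * B n) \<le> block_objective T y \<phi> \<psi> (u (Suc n)) (v n)"
      using block_descent[where N = M and x = "vi n", OF T vmin]
      by (simp add: F_def B_def \<kappa>_def ends block_objective_commute[of T y \<phi> \<psi>])
    then have "F (Suc n) + ereal (\<kappa> * B n) + ereal (\<kappa> * A n)
        \<le> block_objective T y \<phi> \<psi> (u (Suc n)) (v n) + ereal (\<kappa> * A n)"
      by (rule add_right_mono)
    also have "\<dots> \<le> F n"
      using block_descent[where N = L and x = "ui n", OF T umin]
      by (simp add: F_def A_def \<kappa>_def ends)
    finally show ?thesis .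
  qed
  have "(\<lambda>n. \<kappa> * (A (Suc n) + B (Suc n))) \<longlonglongrightarrow> 0"
  proof (rule descent_tendsto_0)
    show "0 \<le> E n" for n
      using F_nonneg[of "Suc n"] by (simp add: F)
    show "0 \<le> \<kappa> * (A (Suc n) + B (Suc n))" for n
      using \<kappa> nonneg_AB by (intro mult_nonneg_nonneg add_nonneg_nonneg) auto
    show "E (Suc n) + \<kappa> * (A (Suc n) + B (Suc n)) \<le> E n" for n
      using descent[of "Suc n"] by (simp add: F algebra_simps)
  qed
  then have "(\<lambda>n. \<kappa> * (A (Suc n) + B (Suc n)) / \<kappa>) \<longlonglongrightarrow> 0 / \<kappa>"
    using \<kappa> by (intro tendsto_divide tendsto_const) auto
  then have "(\<lambda>n. A (Suc n) + B (Suc n)) \<longlonglongrightarrow> 0"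
    using \<kappa> by simp
  then have AB: "(\<lambda>n. A n + B n) \<longlonglongrightarrow> 0"
    by (rule LIMSEQ_imp_Suc)
  have "A \<longlonglongrightarrow> 0" "B \<longlonglongrightarrow> 0"
    by (rule tendsto_sandwich[OF _ _ tendsto_const AB]; simp add: nonneg_AB)+
  note null = this[unfolded A_def B_def, THEN tendsto_0_if_power2_sum_tendsto_0]
  show "l < L \<Longrightarrow> (\<lambda>n. ui n (Suc l) - ui n l) \<longlonglongrightarrow> 0"
    and "l < M \<Longrightarrow> (\<lambda>n. vi n (Suc l) - vi n l) \<longlonglongrightarrow> 0"
    by (fact null)+
qed

section \<open>The functional with powers as penalties\<close>

lemma ell_norm_powr: "0 < r \<Longrightarrow> ell_norm r x powr r = (\<Sum>\<^sub>\<infinity>i. \<bar>x i\<bar> powr r)"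
  by (simp add: ell_norm_def powr_powr infsum_nonneg)

text \<open>The coordinates of \<open>x\<close> are bounded by \<open>\<parallel>x\<parallel>\<close>, so \<open>\<bar>x\<^sub>i\<bar>\<^sup>q \<le> \<parallel>x\<parallel>\<^bsup>q-2\<^esup> x\<^sub>i\<^sup>2\<close>.\<close>

lemma ell2_in_ell:
  fixes x :: "'i ell2"
  assumes "2 \<le> q"
  shows "coord x \<in> ell q"
  unfolding ell_def mem_Collect_eq
proof (rule summable_on_comparison_test)
  show "(\<lambda>i. (norm x) powr (q - 2) * (coord x i)\<^sup>2) summable_on UNIV"
    by (intro summable_on_cmult_right has_sum_imp_summable[OF norm_ell2_has_sum])
  fix i :: 'i
  have "norm (unit_ell2 i) = 1"
    by (simp add: norm_eq_sqrt_inner inner_unit_ell2 unit_ell2.rep_eq)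
  then have "\<bar>coord x i\<bar> \<le> norm x"
    using Cauchy_Schwarz_ineq2[of x "unit_ell2 i"] by (simp add: inner_unit_ell2)
  then have "\<bar>coord x i\<bar> powr (q - 2) * \<bar>coord x i\<bar> powr 2 \<le> norm x powr (q - 2) * \<bar>coord x i\<bar> powr 2"
    using assms by (intro mult_right_mono powr_mono2) auto
  also have "\<bar>coord x i\<bar> powr (q - 2) * \<bar>coord x i\<bar> powr 2 = \<bar>coord x i\<bar> powr q"
    by (simp only: powr_add[symmetric]) simp
  finally show "\<bar>coord x i\<bar> powr q \<le> (norm x) powr (q - 2) * (coord x i)\<^sup>2"
    by simp
qed simp

lemma penalty_powr:
  assumes "\<alpha> \<noteq> 0" and "0 < p"
  shows "penalty (\<lambda>t. \<alpha> * \<bar>t\<bar> powr p) x =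
    (if coord x \<in> ell p then ereal (\<alpha> * ell_norm p (coord x) powr p) else \<infinity>)"
  using assms by (simp add: penalty_def ell_def ell_norm_powr summable_on_cmult_right' infsum_cmult_right')

lemma penalty_powr_plus_square:
  assumes "2 \<le> q"
  shows "penalty (\<lambda>t. \<beta> * \<bar>t\<bar> powr q + \<epsilon> * t\<^sup>2) x =
    ereal (\<beta> * ell_norm q (coord x) powr q + \<epsilon> * (norm x)\<^sup>2)"
proof -
  have "((\<lambda>i. \<bar>coord x i\<bar> powr q) has_sum ell_norm q (coord x) powr q) UNIV"
    using ell2_in_ell[OF assms, of x] assms by (simp add: ell_norm_powr ell_def)
  then have "((\<lambda>i. \<beta> * \<bar>coord x i\<bar> powr q + \<epsilon> * (coord x i)\<^sup>2) has_sum
      \<beta> * ell_norm q (coord x) powr q + \<epsilon> * (norm x)\<^sup>2) UNIV"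
    by (intro has_sum_add has_sum_cmult_right norm_ell2_has_sum)
  then show ?thesis
    by (auto simp: penalty_def infsumI dest: has_sum_imp_summable)
qed

lemma J_eq_block_objective:
  assumes "\<alpha> > 0" and "0 < p" and "2 \<le> q"
  shows "J T y \<alpha> \<beta> \<epsilon> p q u v =
    block_objective T y (\<lambda>t. \<alpha> * \<bar>t\<bar> powr p) (\<lambda>t. \<beta> * \<bar>t\<bar> powr q + \<epsilon> * t\<^sup>2) u v"
  using assms by (simp add: J_def block_objective_def penalty_powr penalty_powr_plus_square ell2_in_ell)

section \<open>Weak accumulation points of the alternating algorithm\<close>

theorem theorem1:
  fixes T :: "'i::countable ell2 \<Rightarrow> 'h::{real_inner, polish_space}"
    and y :: 'h
    and \<alpha> \<beta> \<epsilon> p q :: real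
    and L M :: nat
    and u v :: "nat \<Rightarrow> 'i ell2"
    and u_inf v_inf :: "'i ell2"
    and r :: "nat \<Rightarrow> nat"
  assumes "bounded_linear T" and "onorm T < 1"
    and "\<alpha> > 0" and "\<beta> > 0" and "\<epsilon> > 0"
    and "0 < p" and "p < 1" and "2 \<le> q"
    and "L \<ge> 1" and "M \<ge> 1"
    and "alternating_algorithm T y \<alpha> \<beta> \<epsilon> p q L M u v"
    and "strict_mono r"
    and "weakly_tendsto (u \<circ> r) u_inf"
    and "weakly_tendsto (v \<circ> r) v_inf"
  shows "is_arg_min (\<lambda>w. surrogate_u T y \<alpha> \<beta> \<epsilon> p q w v_inf u_inf) (\<lambda>_. True) u_inf
    \<and> is_arg_min (\<lambda>w. surrogate_v T y \<alpha> \<beta> \<epsilon> p q u_inf w v_inf) (\<lambda>_. True) v_inf"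
proof -
  note T = assms(1)
  define \<phi> where "\<phi> t = \<alpha> * \<bar>t\<bar> powr p" for t
  define \<psi> where "\<psi> t = \<beta> * \<bar>t\<bar> powr q + \<epsilon> * t\<^sup>2" for t
  have \<phi>: "\<phi> 0 = 0" "\<And>t. 0 \<le> \<phi> t" "continuous_on UNIV \<phi>"
    and \<psi>: "\<psi> 0 = 0" "\<And>t. 0 \<le> \<psi> t" "continuous_on UNIV \<psi>"
    using assms by (auto simp: \<phi>_def[abs_def] \<psi>_def[abs_def] intro!: continuous_intros continuous_on_powr')
  have fin_v: "penalty \<psi> w \<noteq> \<infinity>" for w :: "'i ell2"
    by (simp add: \<psi>_def[abs_def] penalty_powr_plus_square[OF \<open>2 \<le> q\<close>])
  have J: "J T y \<alpha> \<beta> \<epsilon> p q = block_objective T y \<phi> \<psi>"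
    using assms by (simp add: fun_eq_iff J_eq_block_objective \<phi>_def[abs_def] \<psi>_def[abs_def])
  have su: "surrogate_u T y \<alpha> \<beta> \<epsilon> p q = block_surrogate T y \<phi> \<psi>"
    by (simp add: fun_eq_iff surrogate_u_def block_surrogate_def J)
  have sv: "surrogate_v T y \<alpha> \<beta> \<epsilon> p q w x a = block_surrogate T y \<psi> \<phi> x w a" for w x a
    by (simp add: surrogate_v_def block_surrogate_def J block_objective_commute[of T y \<psi>])
  obtain ui' vi' where "\<And>n. ui' (Suc n) 0 = u n" "\<And>n. ui' (Suc n) L = u (Suc n)"
      "\<And>n. vi' (Suc n) 0 = v n" "\<And>n. vi' (Suc n) M = v (Suc n)"
    and "\<And>n l w. l < L \<Longrightarrow> block_surrogate T y \<phi> \<psi> (ui' (Suc n) (Suc l)) (v n) (ui' (Suc n) l)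
      \<le> block_surrogate T y \<phi> \<psi> w (v n) (ui' (Suc n) l)"
    and "\<And>n l w. l < M \<Longrightarrow>
      block_surrogate T y \<psi> \<phi> (vi' (Suc n) (Suc l)) (u (Suc n)) (vi' (Suc n) l)
      \<le> block_surrogate T y \<psi> \<phi> w (u (Suc n)) (vi' (Suc n) l)"
    using assms(11) unfolding alternating_algorithm_def is_arg_min_linorder su sv by metis
  \<comment> \<open>Reindexing: sweep \<open>n\<close> leads from \<open>(u n, v n)\<close> to \<open>(u (Suc n), v (Suc n))\<close>.\<close>
  then obtain ui vi where ends: "\<And>n. ui n 0 = u n" "\<And>n. ui n L = u (Suc n)"
      "\<And>n. vi n 0 = v n" "\<And>n. vi n M = v (Suc n)"
    and umin: "\<And>n l w. l < L \<Longrightarrow> block_surrogate T y \<phi> \<psi> (ui n (Suc l)) (v n) (ui n l)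
      \<le> block_surrogate T y \<phi> \<psi> w (v n) (ui n l)"
    and vmin: "\<And>n l w. l < M \<Longrightarrow> block_surrogate T y \<psi> \<phi> (vi n (Suc l)) (u (Suc n)) (vi n l)
      \<le> block_surrogate T y \<psi> \<phi> w (u (Suc n)) (vi n l)"
    by (rule that[of "\<lambda>n. ui' (Suc n)" "\<lambda>n. vi' (Suc n)"])
  obtain L' M' where LM: "L = Suc L'" "M = Suc M'"
    using assms(9,10) by (cases L; cases M) auto
  have fin_u: "penalty \<phi> (u (Suc n)) \<noteq> \<infinity>" for n
    using penalty_finite_if_block_minimal[OF \<phi>(1) fin_v umin[of L' n]] ends(2)[of n] LM by simp
  note vanish = alternating_steps_vanish[where T = T and \<phi> = \<phi> and \<psi> = \<psi>
      and ui = ui and vi = vi and u = u and v = v, OF T assms(2) \<phi>(2) \<psi>(2) umin vmin ends fin_u fin_v]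
  \<comment> \<open>The iterate with index \<open>r (Suc n) > 0\<close> is the outcome of sweep \<open>m n\<close>; along \<open>r\<close> itself the first
    index could be 0, for which no minimality is known.\<close>
  define m where "m n = r (Suc n) - 1" for n
  have m: "r (Suc n) = Suc (m n)" for n
    using strict_mono_less[OF assms(12), of 0 "Suc n"] by (simp add: m_def)
  have "strict_mono m"
    unfolding strict_mono_Suc_iff
  proof
    show "m n < m (Suc n)" for n
      using strict_monoD[OF assms(12), of "Suc n" "Suc (Suc n)"] by (simp add: m)
  qed
  then have m_top: "filterlim m at_top sequentially"
    by (rule filterlim_subseq)
  have u: "weakly_tendsto (\<lambda>n. u (Suc (m n))) u_inf" and v: "weakly_tendsto (\<lambda>n. v (Suc (m n))) v_inf"
    using weakly_tendsto_Suc[OF assms(13)] weakly_tendsto_Suc[OF assms(14)] by (simp_all add: m)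
  have step_u: "(\<lambda>n. u (Suc n) - ui n L') \<longlonglongrightarrow> 0"
    using vanish(1)[of L'] ends(2) by (simp add: LM)
  have step_v: "(\<lambda>n. v (Suc n) - vi n M') \<longlonglongrightarrow> 0"
    using vanish(2)[of M'] ends(4) by (simp add: LM)
  \<comment> \<open>The first block is computed with the previous \<open>v\<close>, which is \<open>M\<close> inner steps away from the new one.\<close>
  have "(\<lambda>n. \<Sum>l<M. vi n (Suc l) - vi n l) \<longlonglongrightarrow> 0"
    by (intro tendsto_null_sum vanish(2)) auto
  then have gap_v: "(\<lambda>n. v (Suc n) - v n) \<longlonglongrightarrow> 0"
    by (simp add: sum_lessThan_telescope ends)
  note along = filterlim_compose[OF _ m_top]
  have u_prev: "weakly_tendsto (\<lambda>n. ui (m n) L') u_inf"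
    using weakly_tendsto_diff_null[OF u along[OF step_u]] .
  have v_inner_prev: "weakly_tendsto (\<lambda>n. vi (m n) M') v_inf"
    using weakly_tendsto_diff_null[OF v along[OF step_v]] .
  have v_prev: "weakly_tendsto (\<lambda>n. v (m n)) v_inf"
    using weakly_tendsto_diff_null[OF v along[OF gap_v]] .
  have "block_surrogate T y \<phi> \<psi> u_inf v_inf u_inf \<le> block_surrogate T y \<phi> \<psi> w v_inf u_inf" for w
  proof (rule block_minimal_weak_limit[OF T \<phi>(2,1,3) _ fin_v u u_prev v_prev])
    show "block_surrogate T y \<phi> \<psi> (u (Suc (m n))) (v (m n)) (ui (m n) L')
        \<le> block_surrogate T y \<phi> \<psi> w (v (m n)) (ui (m n) L')" for n w
      using umin[of L' "m n" w] ends(2)[of "m n"] by (simp add: LM)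
  qed
  moreover have "block_surrogate T y \<psi> \<phi> v_inf u_inf v_inf \<le> block_surrogate T y \<psi> \<phi> w u_inf v_inf" for w
  proof (rule block_minimal_weak_limit[OF T \<psi>(2,1,3) _ fin_u v v_inner_prev u])
    show "block_surrogate T y \<psi> \<phi> (v (Suc (m n))) (u (Suc (m n))) (vi (m n) M')
        \<le> block_surrogate T y \<psi> \<phi> w (u (Suc (m n))) (vi (m n) M')" for n w
      using vmin[of M' "m n" w] ends(4)[of "m n"] by (simp add: LM)
  qed
  ultimately show ?thesis
    unfolding is_arg_min_linorder su sv by blast
qed

end
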